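(* Let $n\ge 1$ and let $p=p_1p_2\cdots p_n$ be a permutation of $\{1,2,\dots,n\}$ with $d(p)$ descents. Then at least $\lceil d(p)/2\rceil$ block moves are needed to sort $p$; that is, any sequence of block moves which transforms $p$ into the increasing permutation $12\cdots n$ consists of at least $\lceil d(p)/2\rceil$ block moves.
   Context: Permutations of $\{1,\dots,n\}$ are written in one-line notation $p=p_1p_2\cdots p_n$. A descent of $p$ is an index $i$ with $1\le i\le n-1$ and $p_i>p_{i+1}$; $d(p)$ denotes the number of descents of $p$. A block of $p$ is a (nonempty) string of consecutive entries $p_ip_{i+1}\cdots p_j$. A block move is the operation that interchanges two disjoint blocks of $p$, which may or may not be adjacent, without changing the order of the entries within each block and leaving all other entries in the same relative order: writing $p$ as a concatenation $p=A\,X\,B\,Y\,C$ with $X,Y$ nonempty strings and $A,B,C$ possibly empty strings, the block move interchanging $X$ and $Y$ produces the permutation $A\,Y\,B\,X\,C$. A sequence of block moves sorts $p$ if applying the moves successively takes $p$ to the increasing permutation $12\cdots n$. *)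

theory Defs
  imports Complex_Main "HOL-Combinatorics.Multiset_Permutations"
begin

text \<open>A permutation of \<open>{1..n}\<close> in one-line notation is a list in
  \<^term>\<open>permutations_of_set {1..n}\<close>.\<close>

text \<open>List positions start at 0, so the usual descent position is \<open>Suc i\<close>.\<close>

definition descents :: "nat list \<Rightarrow> nat set" where
  "descents p = {i. Suc i < length p \<and> p ! i > p ! Suc i}"

definition num_descents :: "nat list \<Rightarrow> nat" where
  "num_descents p = card (descents p)"

definition block_move :: "nat list \<Rightarrow> nat list \<Rightarrow> bool" where
  "block_move p q \<longleftrightarrow>
     (\<exists>A X B Y C. X \<noteq> [] \<and> Y \<noteq> [] \<and>
        p = A @ X @ B @ Y @ C \<and> q = A @ Y @ B @ X @ C)"

end

theory Submission
  imports Defs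
begin

text \<open>
  The increasing permutation has no descents, so it suffices that one block move removes at most
  two of them. A move \<open>A X B Y C \<rightarrow> A Y B X C\<close> keeps every adjacency inside the five strings
  and only changes the junctions between them.

  If \<open>B\<close> is nonempty, the four junctions split into two pairs: the ends of \<open>A\<close> and \<open>B\<close> exchange
  their right neighbours (the beginnings of \<open>X\<close> and \<open>Y\<close>), and the ends of \<open>X\<close> and \<open>Y\<close> exchange
  theirs (the beginnings of \<open>B\<close> and \<open>C\<close>). Such an exchange cannot destroy two descents at once
  without creating one (\<open>junction_descent_exchange\<close>), so each pair loses at most one. If \<open>B\<close> is
  empty, there are only three junctions, and losing a descent at all three would make the six
  entries involved satisfy a cyclic chain of inequalities, some of them strict
  (\<open>junction_descent_rotate\<close>).
\<close>

definition junction_descent :: "nat list \<Rightarrow> nat list \<Rightarrow> nat" where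
  "junction_descent xs ys = of_bool (xs \<noteq> [] \<and> ys \<noteq> [] \<and> last xs > hd ys)"

lemma junction_descent_eq_1_iff:
  "junction_descent xs ys = 1 \<longleftrightarrow> xs \<noteq> [] \<and> ys \<noteq> [] \<and> hd ys < last xs"
  by (simp add: junction_descent_def)

lemma junction_descent_eq_0_iff:
  "junction_descent xs ys = 0 \<longleftrightarrow> xs = [] \<or> ys = [] \<or> last xs \<le> hd ys"
  by (auto simp: junction_descent_def)

lemma junction_descent_le_1: "junction_descent xs ys \<le> 1"
  by (simp add: junction_descent_def)

lemma junction_descent_append_right:
  "ys \<noteq> [] \<Longrightarrow> junction_descent xs (ys @ zs) = junction_descent xs ys"
  by (simp add: junction_descent_def)

lemma finite_descents: "finite (descents xs)"
  by (rule finite_subset[of _ "{..<length xs}"]) (auto simp: descents_def)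

lemma num_descents_Nil [simp]: "num_descents [] = 0"
  by (simp add: num_descents_def descents_def)

lemma num_descents_Cons:
  "num_descents (x # xs) = junction_descent [x] xs + num_descents xs"
proof -
  have "descents (x # xs) = (if xs \<noteq> [] \<and> x > hd xs then {0} else {}) \<union> Suc ` descents xs"
  proof (rule set_eqI)
    fix i
    show "i \<in> descents (x # xs) \<longleftrightarrow>
        i \<in> (if xs \<noteq> [] \<and> x > hd xs then {0} else {}) \<union> Suc ` descents xs"
      by (cases i) (auto simp: descents_def hd_conv_nth)
  qed
  moreover have "card (Suc ` descents xs) = card (descents xs)"
    by (rule card_image) simp
  moreover have "0 \<notin> Suc ` descents xs"
    by blast
  ultimately show ?thesis
    by (simp add: num_descents_def junction_descent_def finite_descents)
qed

lemma num_descents_append: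
  "num_descents (xs @ ys) = num_descents xs + junction_descent xs ys + num_descents ys"
proof (induction xs)
  case Nil
  show ?case
    by (simp add: junction_descent_def)
next
  case (Cons x xs)
  then show ?case
    by (cases xs) (simp_all add: num_descents_Cons junction_descent_def)
qed

text \<open>
  If both junctions on the left are descents, then the larger of the two last entries also
  exceeds both first entries, so one of the junctions on the right is a descent.
\<close>

lemma junction_descent_exchange:
  "junction_descent P X + junction_descent Q Y
     \<le> junction_descent P Y + junction_descent Q X + 1"
proof -
  have "\<not> (junction_descent P Y = 0 \<and> junction_descent Q X = 0)"
    if "junction_descent P X = 1" "junction_descent Q Y = 1"
    using that unfolding junction_descent_eq_1_iff junction_descent_eq_0_iff by linarith
  then show ?thesis
    using junction_descent_le_1[of P X] junction_descent_le_1[of Q Y] by linarith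
qed

text \<open>
  Three descents on the left and none on the right would give
  \<open>last A \<le> hd Y < last X \<le> hd C < last Y \<le> hd X < last A\<close>.
\<close>

lemma junction_descent_rotate:
  "junction_descent A X + junction_descent X Y + junction_descent Y C
     \<le> junction_descent A Y + junction_descent Y X + junction_descent X C + 2"
proof -
  have "\<not> (junction_descent A Y = 0 \<and> junction_descent Y X = 0 \<and> junction_descent X C = 0)"
    if "junction_descent A X = 1" "junction_descent X Y = 1" "junction_descent Y C = 1"
    using that unfolding junction_descent_eq_1_iff junction_descent_eq_0_iff by linarith
  then show ?thesis
    using junction_descent_le_1[of A X] junction_descent_le_1[of X Y] junction_descent_le_1[of Y C]
    by linarith
qed

lemma block_move_num_descents:
  assumes "block_move p q"
  shows "num_descents p \<le> num_descents q + 2"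
proof -
  obtain A X B Y C where ne: "X \<noteq> []" "Y \<noteq> []"
    and p: "p = A @ X @ B @ Y @ C" and q: "q = A @ Y @ B @ X @ C"
    using assms by (auto simp: block_move_def)
  show ?thesis
  proof (cases "B = []")
    case True
    then show ?thesis
      using junction_descent_rotate[of A X Y C] ne
      by (simp add: p q num_descents_append junction_descent_append_right)
  next
    case False
    then show ?thesis
      using junction_descent_exchange[of A X B Y] junction_descent_exchange[of X B Y C] ne
      by (simp add: p q num_descents_append junction_descent_append_right)
  qed
qed

lemma block_moves_num_descents:
  assumes "(block_move ^^ k) p q"
  shows "num_descents p \<le> num_descents q + 2 * k"
  using assms
proof (induction k arbitrary: q)
  case 0
  then show ?case by simp
next
  case (Suc k)
  then obtain r where "(block_move ^^ k) p r" "block_move r q"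
    by auto
  then show ?case
    using Suc.IH[of r] block_move_num_descents[of r q] by simp
qed

lemma num_descents_sorted:
  assumes "sorted p"
  shows "num_descents p = 0"
proof -
  have "\<forall>i. Suc i < length p \<longrightarrow> \<not> p ! i > p ! Suc i"
    by (simp add: not_less sorted_nth_mono[OF assms])
  then have "descents p = {}"
    unfolding descents_def by blast
  then show ?thesis
    by (simp add: num_descents_def)
qed

theorem corollary4:
  fixes n k :: nat and p :: "nat list"
  assumes "n \<ge> 1"
    and "p \<in> permutations_of_set {1..n}"
    and "(block_move ^^ k) p [1..<Suc n]"
  shows "int k \<ge> \<lceil>real (num_descents p) / 2\<rceil>"
proof -
  have "num_descents [1..<Suc n] = 0"
    by (rule num_descents_sorted) (rule sorted_upt)
  then have "num_descents p \<le> 2 * k"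
    using block_moves_num_descents[OF assms(3)] by simp
  then show ?thesis
    by (simp add: ceiling_le_iff)
qed

end
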